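(* A (possibly unbounded) convex open subset of $\mathbb{R}^n$ is resilient to expansion by some radius $r$ if and only if all of its supporting half-spaces (not only the regular ones) are at a common distance $R>r$ from some point.
   Context: Expansion: for $X\subset\mathbb{R}^n$ and $r>0$, $E_r(X)=\bigcup_{x\in X}B(r,x)$, where $B(r,x)$ is the open ball of radius $r$ about $x$. A set $X$ is resilient to expansion by the radius $r>0$ if $E_r(X)=\sigma(X)$ for some similarity transformation $\sigma$, i.e. a map $\sigma:\mathbb{R}^n\to\mathbb{R}^n$ for which there is a scaling factor $\alpha>0$ with $|\sigma(x)-\sigma(y)|=\alpha|x-y|$ for all $x,y$. For a closed convex set $Y\subset\mathbb{R}^n$, a closed half-space $H$ containing $Y$ is a supporting half-space of $Y$ at a boundary point $y$ of $Y$ if $y$ also lies on the boundary of $H$; a boundary point is regular if it has a unique supporting half-space, and a supporting half-space is regular if it is supporting at at least one regular point. The supporting half-spaces of an open convex set are the interiors of the supporting half-spaces of its closure. The distance from a point to a supporting half-space is measured to its boundary hyperplane. *)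

theory Defs
  imports "HOL-Analysis.Analysis"
begin

definition expansion :: "real \<Rightarrow> (real ^ 'n) set \<Rightarrow> (real ^ 'n) set" where
  "expansion r X = (\<Union>x\<in>X. ball x r)"

definition similarity :: "(real ^ 'n \<Rightarrow> real ^ 'n) \<Rightarrow> bool" where
  "similarity \<sigma> \<longleftrightarrow> (\<exists>\<alpha>>0. \<forall>x y. dist (\<sigma> x) (\<sigma> y) = \<alpha> * dist x y)"

definition resilient_to_expansion :: "real \<Rightarrow> (real ^ 'n) set \<Rightarrow> bool" where
  "resilient_to_expansion r X \<longleftrightarrow> (\<exists>\<sigma>. similarity \<sigma> \<and> expansion r X = \<sigma> ` X)"

definition closed_half_space :: "(real ^ 'n) set \<Rightarrow> bool" where
  "closed_half_space H \<longleftrightarrow> (\<exists>a b. a \<noteq> 0 \<and> H = {x. a \<bullet> x \<le> b})"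

definition supporting_half_space_at ::
  "(real ^ 'n) set \<Rightarrow> real ^ 'n \<Rightarrow> (real ^ 'n) set \<Rightarrow> bool" where
  "supporting_half_space_at Y y H \<longleftrightarrow>
     closed_half_space H \<and> Y \<subseteq> H \<and> y \<in> frontier Y \<and> y \<in> frontier H"

text \<open>The set \<open>X\<close> is meant to be open and convex; its supporting half-spaces are open
  half-spaces. The empty set and the whole space have none.\<close>

definition supporting_half_spaces_open :: "(real ^ 'n) set \<Rightarrow> (real ^ 'n) set set" where
  "supporting_half_spaces_open X =
     {interior H | H. \<exists>y. supporting_half_space_at (closure X) y H}"

text \<open>The distance is the unsigned distance to the bounding hyperplane, so the point \<open>p\<close> is
  not required to lie in the half-spaces.\<close>

definition supports_at_common_distance ::
  "(real ^ 'n) set \<Rightarrow> real ^ 'n \<Rightarrow> real \<Rightarrow> bool" where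
  "supports_at_common_distance X p R \<longleftrightarrow>
     (\<forall>U\<in>supporting_half_spaces_open X. infdist p (frontier U) = R)"

end

theory Submission
  imports Defs
begin

text \<open>
  A nonempty convex open set \<open>X\<close> is governed by its outward unit normals \<open>a\<close> at contact points
  \<open>y\<close>: a point \<open>z\<close> lies in \<open>X\<close> iff \<open>a \<bullet> z < a \<bullet> y\<close> for all of them, and in the expansion by \<open>r\<close> iff
  \<open>a \<bullet> z < a \<bullet> y + r\<close> for all of them.

  Suppose that all hyperplanes have distance \<open>R > 0\<close> from \<open>p\<close>. If \<open>p\<close> lies in every half-space, the
  conditions read \<open>a \<bullet> (z - p) < R\<close> and \<open>a \<bullet> (z - p) < R + r\<close>, so the homothety at \<open>p\<close> with
  factor \<open>(R + r) / R\<close> maps \<open>X\<close> onto its expansion. The distance is unsigned, so a half-space may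
  also exclude \<open>p\<close>; then a continuity argument (\<open>outward_normals_eq_if_excludes\<close>) shows that \<open>X\<close>
  has only one supporting half-space, and a translation does the job.

  Conversely, let the expansion by \<open>r\<close> be \<open>\<sigma> ` X\<close> with \<open>\<sigma> x = \<alpha> Q x + v\<close>, \<open>Q\<close> orthogonal. The idea
  is to iterate. Expanding moves every supporting hyperplane outward by \<open>r\<close>, while \<open>\<sigma>\<close> moves it
  affinely and rotates its normal, so the iterates of \<open>\<sigma>\<close> relate the supporting hyperplane with
  normal \<open>a\<close> to those with normals in the orbit of \<open>a\<close> under \<open>Q\<close>. The orthogonal map \<open>Q\<close> is
  recurrent: \<open>Q ^^ k\<close> returns arbitrarily close to the identity. Evaluating at such times, if
  \<open>\<alpha> \<noteq> 1\<close>, forces the signed distance of every supporting hyperplane from the fixed point of \<open>\<sigma>\<close>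
  to be \<open>r / (\<alpha> - 1)\<close> (\<open>signed_distance_eq\<close>); it is negative for \<open>\<alpha> < 1\<close>, which the unsigned
  distance permits. If \<open>\<alpha> = 1\<close>, it forces any two unit normals to agree
  (\<open>outward_normals_eq\<close>), and a suitable point on the normal line has distance \<open>1\<close>.
  Only contact points are tested, at which the supremum of \<open>a\<close> over \<open>X\<close> is attained; this
  is what makes the argument insensitive to unbounded \<open>X\<close>, whose support function need be
  neither bounded nor continuous.
\<close>

section \<open>Outward unit normals\<close>

text \<open>A supporting half-space is encoded by a contact point \<open>y\<close> and the unit normal \<open>a\<close> there,
  since the normal is what the expansion and the similarity act on.\<close>

definition outward_normal :: "'a::euclidean_space set \<Rightarrow> 'a \<Rightarrow> 'a \<Rightarrow> bool" where
  "outward_normal X y a \<longleftrightarrow> norm a = 1 \<and> y \<in> closure X \<and> (\<forall>x\<in>X. a \<bullet> x \<le> a \<bullet> y)"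

lemma inner_le_on_closure:
  fixes a :: "'a::real_inner"
  assumes "\<forall>x\<in>X. a \<bullet> x \<le> b" "x \<in> closure X"
  shows "a \<bullet> x \<le> b"
proof -
  have "closure X \<subseteq> {x. a \<bullet> x \<le> b}"
    by (rule closure_minimal) (use assms(1) closed_halfspace_le in auto)
  then show ?thesis
    using assms(2) by auto
qed

lemma outward_normal_le:
  "outward_normal X y a \<Longrightarrow> x \<in> closure X \<Longrightarrow> a \<bullet> x \<le> a \<bullet> y"
  unfolding outward_normal_def using inner_le_on_closure by blast

lemma outward_normal_less:
  assumes "outward_normal X y a" "open X" "x \<in> X"
  shows "a \<bullet> x < a \<bullet> y"
proof -
  have a: "norm a = 1" and le: "X \<subseteq> {x. a \<bullet> x \<le> a \<bullet> y}"
    using assms(1) by (auto simp: outward_normal_def)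
  have "a \<noteq> 0"
    using a by auto
  then have "X \<subseteq> {x. a \<bullet> x < a \<bullet> y}"
    using interior_maximal[OF le assms(2)] by simp
  then show ?thesis
    using assms(3) by auto
qed

lemma outward_normal_closest_point:
  fixes X :: "'a::euclidean_space set"
  assumes "convex X" "X \<noteq> {}" "z \<notin> closure X"
  defines "q \<equiv> closest_point (closure X) z"
  shows "outward_normal X q ((z - q) /\<^sub>R norm (z - q))"
proof -
  have q: "q \<in> closure X"
    unfolding q_def by (rule closest_point_in_set) (use assms in auto)
  then have "z - q \<noteq> 0"
    using assms by auto
  moreover have "(z - q) \<bullet> x \<le> (z - q) \<bullet> q" if "x \<in> X" for x
  proof -
    have "x \<in> closure X"
      using that closure_subset by blast
    then have "(z - q) \<bullet> (x - q) \<le> 0"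
      unfolding q_def using assms(1) by (intro closest_point_dot) (auto simp: convex_closure)
    then show ?thesis
      by (simp add: inner_diff_right)
  qed
  ultimately show ?thesis
    unfolding outward_normal_def using q by (auto intro!: divide_right_mono simp: divide_inverse_commute[symmetric])
qed

lemma mem_open_convex_iff_outward_normal:
  fixes X :: "'a::euclidean_space set"
  assumes "open X" "convex X" "X \<noteq> {}"
  shows "z \<in> X \<longleftrightarrow> (\<forall>y a. outward_normal X y a \<longrightarrow> a \<bullet> z < a \<bullet> y)"
proof
  assume "z \<in> X"
  then show "\<forall>y a. outward_normal X y a \<longrightarrow> a \<bullet> z < a \<bullet> y"
    using outward_normal_less assms(1) by blast
next
  assume L: "\<forall>y a. outward_normal X y a \<longrightarrow> a \<bullet> z < a \<bullet> y"
  show "z \<in> X"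
  proof (rule ccontr)
    assume z: "z \<notin> X"
    show False
    proof (cases "z \<in> closure X")
      case True
      have "z \<notin> rel_interior X"
        using z rel_interior_subset by blast
      then obtain a where a: "a \<noteq> 0" "\<And>y. y \<in> closure X \<Longrightarrow> a \<bullet> z \<le> a \<bullet> y"
        using supporting_hyperplane_relative_frontier[OF assms(2) True] by metis
      have "a \<bullet> z \<le> a \<bullet> x" if "x \<in> X" for x
        using a(2) that closure_subset by blast
      then have "outward_normal X z (- a /\<^sub>R norm a)"
        unfolding outward_normal_def using a(1) True
        by (auto intro!: divide_right_mono simp: divide_inverse_commute[symmetric])
      then show False
        using L by blast
    next
      case False
      define q where "q = closest_point (closure X) z"
      have "outward_normal X q ((z - q) /\<^sub>R norm (z - q))"
        unfolding q_def by (rule outward_normal_closest_point[OF assms(2,3) False])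
      then have "((z - q) /\<^sub>R norm (z - q)) \<bullet> (z - q) < 0"
        using L by (force simp: inner_diff_right)
      moreover have "((z - q) /\<^sub>R norm (z - q)) \<bullet> (z - q) \<ge> 0"
        by simp
      ultimately show False
        by linarith
    qed
  qed
qed

text \<open>The frontier conditions on a supporting half-space only say that the hyperplane passes
  through \<open>y\<close>: a point of the closure at which a nonzero linear functional is maximal cannot be
  interior.\<close>

lemma supporting_half_spaces_open_eq:
  fixes X :: "(real ^ 'n) set"
  shows "supporting_half_spaces_open X = {{x. a \<bullet> x < a \<bullet> y} | y a. outward_normal X y a}"
proof (intro equalityI subsetI)
  fix U assume "U \<in> supporting_half_spaces_open X"
  then obtain H y where U: "U = interior H" and H: "supporting_half_space_at (closure X) y H"
    unfolding supporting_half_spaces_open_def by auto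
  then obtain a b where a: "a \<noteq> 0" and Heq: "H = {x. a \<bullet> x \<le> b}"
    unfolding supporting_half_space_at_def closed_half_space_def by auto
  have y: "a \<bullet> y = b" "y \<in> closure X" and sub: "closure X \<subseteq> H"
    using H a unfolding supporting_half_space_at_def Heq
    by (auto simp: frontier_halfspace_le frontier_def)
  have "a \<bullet> x \<le> a \<bullet> y" if "x \<in> X" for x
    using sub closure_subset that y Heq by blast
  then have "outward_normal X y (a /\<^sub>R norm a)"
    unfolding outward_normal_def using a y
    by (auto intro!: divide_right_mono simp: divide_inverse_commute[symmetric])
  moreover have "U = {x. (a /\<^sub>R norm a) \<bullet> x < (a /\<^sub>R norm a) \<bullet> y}"
    using U Heq a y by (simp add: divide_inverse_commute[symmetric] divide_strict_right_mono divide_less_cancel)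
  ultimately show "U \<in> {{x. a \<bullet> x < a \<bullet> y} | y a. outward_normal X y a}"
    by blast
next
  fix U assume "U \<in> {{x. a \<bullet> x < a \<bullet> y} | y a. outward_normal X y a}"
  then obtain y a where U: "U = {x. a \<bullet> x < a \<bullet> y}" and n: "outward_normal X y a"
    by auto
  define H where "H = {x. a \<bullet> x \<le> a \<bullet> y}"
  have a: "a \<noteq> 0" and y: "y \<in> closure X"
    using n by (auto simp: outward_normal_def)
  have sub: "closure X \<subseteq> H"
    using n outward_normal_le unfolding H_def by blast
  have intH: "interior H = U"
    unfolding H_def U using a by simp
  have "y \<notin> interior (closure X)"
    using interior_mono[OF sub] intH U by auto
  then have "y \<in> frontier (closure X)"
    using y by (simp add: frontier_def)
  moreover have "closed_half_space H"
    unfolding closed_half_space_def H_def using a by blast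
  moreover have "y \<in> frontier H"
    unfolding H_def using a by (simp add: frontier_halfspace_le)
  ultimately have "supporting_half_space_at (closure X) y H"
    unfolding supporting_half_space_at_def using sub by blast
  then show "U \<in> supporting_half_spaces_open X"
    unfolding supporting_half_spaces_open_def using intH by blast
qed

lemma infdist_hyperplane:
  fixes a p :: "'a::euclidean_space"
  assumes "norm a = 1"
  shows "infdist p {x. a \<bullet> x = b} = \<bar>a \<bullet> p - b\<bar>"
proof (rule antisym)
  have aa: "a \<bullet> a = 1"
    using assms by (simp add: norm_eq_1)
  define q where "q = p - (a \<bullet> p - b) *\<^sub>R a"
  have q: "q \<in> {x. a \<bullet> x = b}"
    by (simp add: q_def aa inner_diff_right)
  then have "infdist p {x. a \<bullet> x = b} \<le> dist p q"
    by (rule infdist_le)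
  then show "infdist p {x. a \<bullet> x = b} \<le> \<bar>a \<bullet> p - b\<bar>"
    by (simp add: q_def dist_norm assms)
  have "\<bar>a \<bullet> p - b\<bar> \<le> dist p x" if "a \<bullet> x = b" for x
    using Cauchy_Schwarz_ineq2[of a "p - x"] that assms by (simp add: dist_norm inner_diff_right)
  then show "\<bar>a \<bullet> p - b\<bar> \<le> infdist p {x. a \<bullet> x = b}"
    using q by (subst infdist_notempty) (auto intro!: cINF_greatest)
qed

lemma supports_at_common_distance_iff:
  fixes X :: "(real ^ 'n) set"
  shows "supports_at_common_distance X p R \<longleftrightarrow>
    (\<forall>y a. outward_normal X y a \<longrightarrow> \<bar>a \<bullet> (y - p)\<bar> = R)"
proof -
  have inf: "infdist p (frontier {x. a \<bullet> x < a \<bullet> y}) = \<bar>a \<bullet> (y - p)\<bar>" if "outward_normal X y a" for y a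
  proof -
    have "norm a = 1" "a \<noteq> 0"
      using that by (auto simp: outward_normal_def)
    then show ?thesis
      by (simp add: frontier_halfspace_lt infdist_hyperplane inner_diff_right abs_minus_commute)
  qed
  have "supports_at_common_distance X p R \<longleftrightarrow>
      (\<forall>y a. outward_normal X y a \<longrightarrow> infdist p (frontier {x. a \<bullet> x < a \<bullet> y}) = R)"
    unfolding supports_at_common_distance_def supporting_half_spaces_open_eq by blast
  then show ?thesis
    by (simp only: inf cong: imp_cong)
qed

section \<open>Expansion and supporting half-spaces\<close>

lemma mem_expansion_iff: "z \<in> expansion r X \<longleftrightarrow> (\<exists>x\<in>X. dist x z < r)"
  by (simp add: expansion_def)

lemma expansion_empty [simp]: "expansion r {} = {}"
  by (simp add: expansion_def)

text \<open>A point outside the expansion is at distance at least \<open>r\<close> from its nearest point in the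
  closure, and the normal there already excludes it by \<open>r\<close>.\<close>

lemma mem_expansion_iff_outward_normal:
  fixes X :: "(real ^ 'n) set"
  assumes "convex X" "X \<noteq> {}" "r > 0"
  shows "z \<in> expansion r X \<longleftrightarrow> (\<forall>y a. outward_normal X y a \<longrightarrow> a \<bullet> z < a \<bullet> y + r)"
proof
  assume "z \<in> expansion r X"
  then obtain x where x: "x \<in> X" "dist x z < r"
    by (auto simp: mem_expansion_iff)
  show "\<forall>y a. outward_normal X y a \<longrightarrow> a \<bullet> z < a \<bullet> y + r"
  proof (intro allI impI)
    fix y a assume n: "outward_normal X y a"
    have "a \<bullet> (z - x) \<le> norm a * norm (z - x)"
      by (rule norm_cauchy_schwarz)
    also have "\<dots> < r"
      using n x(2) by (simp add: outward_normal_def dist_norm norm_minus_commute)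
    finally have "a \<bullet> z < a \<bullet> x + r"
      by (simp add: inner_diff_right)
    moreover have "a \<bullet> x \<le> a \<bullet> y"
      using n x(1) by (auto simp: outward_normal_def)
    ultimately show "a \<bullet> z < a \<bullet> y + r"
      by linarith
  qed
next
  assume L: "\<forall>y a. outward_normal X y a \<longrightarrow> a \<bullet> z < a \<bullet> y + r"
  define q where "q = closest_point (closure X) z"
  have q: "q \<in> closure X"
    unfolding q_def by (rule closest_point_in_set) (use assms in auto)
  have "dist q z < r"
  proof (cases "z \<in> closure X")
    case True
    then show ?thesis
      using assms(3) by (simp add: q_def closest_point_self)
  next
    case False
    define u where "u = (z - q) /\<^sub>R norm (z - q)"
    have "z \<noteq> q"
      using False q by auto
    then have "u \<bullet> (z - q) = norm (z - q)"
      by (simp add: u_def dot_square_norm power2_eq_square)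
    moreover have "outward_normal X q u"
      unfolding u_def q_def by (rule outward_normal_closest_point[OF assms(1,2) False])
    ultimately show ?thesis
      using L by (force simp: inner_diff_right dist_norm norm_minus_commute)
  qed
  then have "r - dist q z > 0"
    by simp
  then obtain x where "x \<in> X" "dist x q < r - dist q z"
    using q unfolding closure_approachable by blast
  then show "z \<in> expansion r X"
    using dist_triangle[of x z q] by (force simp: mem_expansion_iff)
qed

lemma bounded_above_on_expansion_iff:
  fixes X :: "(real ^ 'n) set"
  assumes "r > 0"
  shows "(\<forall>z\<in>expansion r X. a \<bullet> z \<le> b + r * norm a) \<longleftrightarrow> (\<forall>x\<in>X. a \<bullet> x \<le> b)"
proof
  assume L: "\<forall>z\<in>expansion r X. a \<bullet> z \<le> b + r * norm a"
  show "\<forall>x\<in>X. a \<bullet> x \<le> b"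
  proof
    fix x assume x: "x \<in> X"
    \<comment> \<open>the point of the closed ball around \<open>x\<close> that is extreme in the direction \<open>a\<close>\<close>
    define z where "z = x + (r / norm a) *\<^sub>R a"
    have "z \<in> closure (ball x r)"
      using assms by (cases "a = 0") (auto simp: z_def dist_norm)
    moreover have "\<forall>z\<in>ball x r. a \<bullet> z \<le> b + r * norm a"
      using L x by (auto simp: expansion_def)
    ultimately have "a \<bullet> z \<le> b + r * norm a"
      using inner_le_on_closure by blast
    moreover have "a \<bullet> z = a \<bullet> x + r * norm a"
      by (cases "a = 0") (auto simp: z_def inner_add_right dot_square_norm power2_eq_square)
    ultimately show "a \<bullet> x \<le> b"
      by simp
  qed
next
  assume R: "\<forall>x\<in>X. a \<bullet> x \<le> b"
  show "\<forall>z\<in>expansion r X. a \<bullet> z \<le> b + r * norm a"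
  proof
    fix z assume "z \<in> expansion r X"
    then obtain x where x: "x \<in> X" "dist x z < r"
      by (auto simp: mem_expansion_iff)
    have "a \<bullet> (z - x) \<le> norm a * norm (z - x)"
      by (rule norm_cauchy_schwarz)
    also have "\<dots> \<le> norm a * r"
      using x(2) by (intro mult_left_mono) (auto simp: dist_norm norm_minus_commute)
    finally show "a \<bullet> z \<le> b + r * norm a"
      using R x(1) by (force simp: inner_diff_right mult.commute)
  qed
qed

section \<open>Common distance implies resilience\<close>

lemma expansion_eq_image_if_pushes_supports:
  fixes X :: "(real ^ 'n) set"
  assumes "open X" "convex X" "X \<noteq> {}" "r > 0" "surj \<sigma>"
    and push: "\<And>y a z. outward_normal X y a \<Longrightarrow> a \<bullet> \<sigma> z < a \<bullet> y + r \<longleftrightarrow> a \<bullet> z < a \<bullet> y"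
  shows "expansion r X = \<sigma> ` X"
proof -
  have "\<sigma> z \<in> expansion r X \<longleftrightarrow> z \<in> X" for z
    unfolding mem_expansion_iff_outward_normal[OF assms(2-4)]
      mem_open_convex_iff_outward_normal[OF assms(1-3)] using push by blast
  then show ?thesis
    using assms(5) by (force simp: surj_def image_iff)
qed

text \<open>If some supporting half-space excludes \<open>p\<close>, then \<open>p\<close> lies outside the closure, and the
  nearest point yields a normal \<open>u\<close> of signed distance \<open>-R\<close>. A different normal \<open>a1\<close> of signed
  distance \<open>-R\<close> would exclude the nearest point. If \<open>a1\<close> has signed distance \<open>R\<close>, walk from \<open>p\<close> to a
  point far out on the normal ray at \<open>y1\<close>: the nearest point and its normal vary continuously as long
  as the path stays outside the closure, so the signed distance takes the value \<open>0\<close> somewhere.\<close>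

lemma outward_normals_eq_if_excludes:
  fixes X :: "'a::euclidean_space set"
  assumes "open X" "convex X" "X \<noteq> {}" "R > 0"
    and dist: "\<And>y a. outward_normal X y a \<Longrightarrow> \<bar>a \<bullet> (y - p)\<bar> = R"
    and n0: "outward_normal X y0 a0" "a0 \<bullet> (y0 - p) < 0"
  shows "\<exists>u. \<forall>y a. outward_normal X y a \<longrightarrow> a = u"
proof -
  define \<pi> where "\<pi> = closest_point (closure X)"
  define N where "N z = (z - \<pi> z) /\<^sub>R norm (z - \<pi> z)" for z
  have cl: "convex (closure X)" "closed (closure X)" "closure X \<noteq> {}"
    using assms by (auto simp: convex_closure)
  have \<pi>_in: "\<pi> z \<in> closure X" for z
    unfolding \<pi>_def by (rule closest_point_in_set) (use cl in auto)
  have N: "outward_normal X (\<pi> z) (N z)" if "z \<notin> closure X" for z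
    unfolding N_def \<pi>_def by (rule outward_normal_closest_point[OF assms(2,3) that])
  have p: "p \<notin> closure X"
    using outward_normal_le[OF n0(1)] n0(2) by (fastforce simp: inner_diff_right)
  define q where "q = \<pi> p"
  define u where "u = N p"
  have u: "outward_normal X q u"
    using N[OF p] by (simp add: q_def u_def)
  have "p \<noteq> q"
    using p \<pi>_in q_def by metis
  then have u_q: "u \<bullet> (p - q) = norm (p - q)"
    by (simp add: u_def N_def q_def dot_square_norm power2_eq_square)
  then have pq: "norm (p - q) = R"
    using dist[OF u] by (simp add: inner_diff_right abs_minus_commute)
  have uR: "u \<bullet> (q - p) = - R"
    using u_q pq by (simp add: inner_diff_right)
  have q_eq: "q - p = - R *\<^sub>R u"
    using pq assms(4) by (simp add: u_def N_def q_def[symmetric])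
  have "a1 = u" if n1: "outward_normal X y1 a1" for y1 a1
  proof (rule ccontr)
    assume ne: "a1 \<noteq> u"
    have unit: "a1 \<bullet> a1 = 1" "u \<bullet> u = 1"
      using n1 u by (auto simp: outward_normal_def norm_eq_1)
    have "(a1 - u) \<bullet> (a1 - u) > 0"
      using ne by simp
    then have less1: "u \<bullet> a1 < 1"
      by (simp add: inner_diff_left inner_diff_right unit inner_commute)
    have "a1 \<bullet> q \<le> a1 \<bullet> y1"
      using outward_normal_le[OF n1] u by (auto simp: outward_normal_def)
    then have "a1 \<bullet> (q - p) \<le> a1 \<bullet> (y1 - p)"
      by (simp add: inner_diff_right)
    then have "- (R * (u \<bullet> a1)) \<le> a1 \<bullet> (y1 - p)"
      by (simp add: q_eq inner_commute)
    moreover have "R * (u \<bullet> a1) < R"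
      using less1 assms(4) by simp
    ultimately have y1: "a1 \<bullet> (y1 - p) = R"
      using dist[OF n1] by linarith
    show False
    proof (cases "u \<bullet> a1 = -1")
      case True
      have "(a1 + u) \<bullet> (a1 + u) = 0"
        using True by (simp add: inner_add_left inner_add_right unit inner_commute)
      then have a1: "a1 = - u"
        by (simp add: add_eq_0_iff2)
      obtain x where x: "x \<in> X"
        using assms(3) by blast
      have "u \<bullet> x < u \<bullet> q" "a1 \<bullet> x < a1 \<bullet> y1"
        using outward_normal_less assms(1) u n1 x by blast+
      then show False
        using uR y1 by (simp add: a1 inner_diff_right)
    next
      case False
      have "\<bar>u \<bullet> a1\<bar> \<le> 1"
        using Cauchy_Schwarz_ineq2[of u a1] unit by (simp add: norm_eq_sqrt_inner)
      then have pos: "1 + u \<bullet> a1 > 0"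
        using False by linarith
      \<comment> \<open>so far out that, at every time, the segment from \<open>p\<close> violates the inequality of \<open>u\<close> or
        that of \<open>a1\<close>\<close>
      define s where "s = (\<bar>u \<bullet> (y1 - p)\<bar> + 1) / (1 + u \<bullet> a1)"
      have s: "s > 0"
        unfolding s_def using pos by (intro divide_pos_pos) auto
      have "s * (1 + u \<bullet> a1) = \<bar>u \<bullet> (y1 - p)\<bar> + 1"
        using pos by (simp add: s_def)
      then have s_big: "R + s + u \<bullet> (y1 - p) + s * (u \<bullet> a1) > 0"
        using assms(4) by (simp add: algebra_simps)
      define d where "d = y1 + s *\<^sub>R a1 - p"
      define g where "g t = p + t *\<^sub>R d" for t
      have ud: "u \<bullet> d = u \<bullet> (y1 - p) + s * (u \<bullet> a1)"
        by (simp add: d_def algebra_simps)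
      have a1d: "a1 \<bullet> d = R + s"
        using y1 by (simp add: d_def algebra_simps unit)
      have out: "g t \<notin> closure X" if t: "t \<ge> 0" for t
      proof
        assume "g t \<in> closure X"
        then have "u \<bullet> g t \<le> u \<bullet> q" "a1 \<bullet> g t \<le> a1 \<bullet> y1"
          using outward_normal_le u n1 by blast+
        then have 1: "t * (u \<bullet> d) \<le> - R" and 2: "t * (R + s) \<le> R"
          using uR y1 a1d by (auto simp: g_def inner_diff_right inner_add_right)
        have "t * (R + s + u \<bullet> d) \<le> 0"
          using 1 2 by (simp add: algebra_simps)
        moreover have "t \<noteq> 0"
          using 1 assms(4) by auto
        ultimately show False
          using t s_big ud by (simp add: mult_le_0_iff)
      qed
      define f where "f t = N (g t) \<bullet> (\<pi> (g t) - p)" for t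
      have cont_g: "continuous_on {0..1} g"
        unfolding g_def by (intro continuous_intros)
      have cont_\<pi>: "continuous_on {0..1} (\<lambda>t. \<pi> (g t))"
        unfolding \<pi>_def
        by (rule continuous_on_compose2[OF continuous_on_closest_point[OF cl] cont_g]) auto
      have "g t - \<pi> (g t) \<noteq> 0" if "t \<in> {0..1}" for t
        using out[of t] that \<pi>_in[of "g t"] by auto
      then have cont: "continuous_on {0..1} f"
        unfolding f_def N_def by (intro continuous_intros cont_g cont_\<pi>) auto
      have f0: "f 0 = - R"
        using uR by (simp add: f_def g_def u_def q_def)
      have g1: "g 1 = y1 + s *\<^sub>R a1"
        by (simp add: g_def d_def)
      have na1: "norm a1 = 1"
        using n1 by (simp add: outward_normal_def)
      have y1_near: "y1 = \<pi> (g 1)"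
        unfolding \<pi>_def
      proof (rule closest_point_unique[OF cl(1,2)])
        show "y1 \<in> closure X"
          using n1 by (simp add: outward_normal_def)
        show "\<forall>z\<in>closure X. dist (g 1) y1 \<le> dist (g 1) z"
        proof
          fix z assume "z \<in> closure X"
          then have "a1 \<bullet> z \<le> a1 \<bullet> y1"
            by (rule outward_normal_le[OF n1])
          then have "s \<le> a1 \<bullet> (g 1 - z)"
            by (simp add: g1 algebra_simps unit)
          also have "\<dots> \<le> norm a1 * norm (g 1 - z)"
            by (rule norm_cauchy_schwarz)
          finally show "dist (g 1) y1 \<le> dist (g 1) z"
            using s by (simp add: g1 dist_norm na1)
        qed
      qed
      have "N (g 1) = a1"
        unfolding N_def y1_near[symmetric] using s by (simp add: g1 na1)
      then have f1: "f 1 = R"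
        using y1 y1_near by (simp add: f_def)
      have "\<exists>t\<ge>0. t \<le> 1 \<and> f t = 0"
        by (rule IVT') (use f0 f1 assms(4) cont in auto)
      then obtain t where t: "t \<ge> 0" "f t = 0"
        by blast
      have "\<bar>f t\<bar> = R"
        unfolding f_def by (rule dist[OF N[OF out[OF t(1)]]])
      then show False
        using t(2) assms(4) by simp
    qed
  qed
  then show ?thesis
    by blast
qed

lemma resilient_if_supports_at_common_distance:
  fixes X :: "(real ^ 'n) set"
  assumes "open X" "convex X" "r > 0" "R > 0" "supports_at_common_distance X p R"
  shows "resilient_to_expansion r X"
proof (cases "X = {}")
  case True
  have "similarity (\<lambda>x :: real ^ 'n. x)"
    unfolding similarity_def by (intro exI[of _ 1]) auto
  then show ?thesis
    unfolding resilient_to_expansion_def True by auto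
next
  case False
  have dist: "\<bar>a \<bullet> (y - p)\<bar> = R" if "outward_normal X y a" for y a
    using assms(5) that by (simp add: supports_at_common_distance_iff)
  show ?thesis
  proof (cases "\<exists>y a. outward_normal X y a \<and> a \<bullet> (y - p) < 0")
    case True
    then obtain u where u: "\<And>y a. outward_normal X y a \<Longrightarrow> a = u"
      using outward_normals_eq_if_excludes[OF assms(1,2) False assms(4) dist] by blast
    have nu: "u \<bullet> u = 1"
      using True u by (metis outward_normal_def norm_eq_1)
    define \<sigma> where "\<sigma> = (\<lambda>z. z + r *\<^sub>R u)"
    have "similarity \<sigma>"
      unfolding similarity_def \<sigma>_def by (intro exI[of _ 1]) auto
    moreover have "expansion r X = \<sigma> ` X"
    proof (rule expansion_eq_image_if_pushes_supports[OF assms(1,2) False assms(3)])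
      show "surj \<sigma>"
        by (rule surjI[of _ "\<lambda>z. z - r *\<^sub>R u"]) (simp add: \<sigma>_def)
      show "a \<bullet> \<sigma> z < a \<bullet> y + r \<longleftrightarrow> a \<bullet> z < a \<bullet> y" if "outward_normal X y a" for y a z
        using u[OF that] nu by (simp add: \<sigma>_def inner_add_right)
    qed
    ultimately show ?thesis
      unfolding resilient_to_expansion_def by blast
  next
    case pos: False
    define k where "k = (R + r) / R"
    have k: "k > 0"
      using assms by (simp add: k_def)
    define \<sigma> where "\<sigma> = (\<lambda>z. p + k *\<^sub>R (z - p))"
    have "dist (\<sigma> x) (\<sigma> y) = k * dist x y" for x y
    proof -
      have "\<sigma> x - \<sigma> y = k *\<^sub>R (x - y)"
        by (simp add: \<sigma>_def algebra_simps)
      then show ?thesis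
        using k by (simp add: dist_norm)
    qed
    then have "similarity \<sigma>"
      unfolding similarity_def using k by blast
    moreover have "expansion r X = \<sigma> ` X"
    proof (rule expansion_eq_image_if_pushes_supports[OF assms(1,2) False assms(3)])
      show "surj \<sigma>"
        by (rule surjI[of _ "\<lambda>z. p + (z - p) /\<^sub>R k"]) (use k in \<open>simp add: \<sigma>_def\<close>)
      show "a \<bullet> \<sigma> z < a \<bullet> y + r \<longleftrightarrow> a \<bullet> z < a \<bullet> y" if n: "outward_normal X y a" for y a z
      proof -
        have y: "a \<bullet> y = a \<bullet> p + R"
          using dist[OF n] pos n by (force simp: inner_diff_right)
        have "R + r = k * R"
          using assms by (simp add: k_def)
        then have "k * (a \<bullet> (z - p)) < R + r \<longleftrightarrow> a \<bullet> (z - p) < R"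
          using k by simp
        then show ?thesis
          by (auto simp: \<sigma>_def inner_add_right inner_diff_right y)
      qed
    qed
    ultimately show ?thesis
      unfolding resilient_to_expansion_def by blast
  qed
qed

section \<open>Recurrence of isometries\<close>

lemma isometry_funpow:
  fixes f :: "'a::metric_space \<Rightarrow> 'a"
  assumes "\<And>x y. dist (f x) (f y) = dist x y"
  shows "dist ((f ^^ k) x) ((f ^^ k) y) = dist x y"
  by (induction k) (auto simp: assms)

text \<open>Two orbit points at late, far apart times come close to each other by compactness; applying
  the isometry backwards turns them into the starting point and a late orbit point.\<close>

lemma isometry_recurrent:
  fixes f :: "'a::heine_borel \<Rightarrow> 'a"
  assumes iso: "\<And>x y. dist (f x) (f y) = dist x y"
    and bdd: "bounded (range (\<lambda>k. (f ^^ k) a))"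
  obtains s :: "nat \<Rightarrow> nat"
  where "filterlim s at_top sequentially" "(\<lambda>j. (f ^^ s j) a) \<longlonglongrightarrow> a"
proof -
  obtain l g where g: "strict_mono (g :: nat \<Rightarrow> nat)" and lim: "((\<lambda>k. (f ^^ k) a) \<circ> g) \<longlonglongrightarrow> l"
    using bounded_imp_convergent_subsequence[OF bdd] by blast
  have ret: "\<exists>k\<ge>n. dist ((f ^^ k) a) a < inverse (real (Suc n))" for n
  proof -
    have "Cauchy ((\<lambda>k. (f ^^ k) a) \<circ> g)"
      using lim by (rule LIMSEQ_imp_Cauchy)
    moreover have "inverse (real (Suc n)) > 0"
      by simp
    ultimately obtain M where M: "\<And>i j. i \<ge> M \<Longrightarrow> j \<ge> M \<Longrightarrow>
        dist ((f ^^ g i) a) ((f ^^ g j) a) < inverse (real (Suc n))"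
      unfolding Cauchy_def o_def by meson
    define j where "j = M + g M + n"
    have "j \<le> g j"
      using g by (rule strict_mono_imp_increasing)
    then have gj: "g j = g M + (g j - g M)" and k: "n \<le> g j - g M"
      by (auto simp: j_def)
    have "dist ((f ^^ (g j - g M)) a) a = dist ((f ^^ g M) ((f ^^ (g j - g M)) a)) ((f ^^ g M) a)"
      by (simp add: isometry_funpow iso)
    also have "(f ^^ g M) ((f ^^ (g j - g M)) a) = (f ^^ g j) a"
      using gj by (metis comp_apply funpow_add)
    also have "dist ((f ^^ g j) a) ((f ^^ g M) a) < inverse (real (Suc n))"
      by (rule M) (auto simp: j_def)
    finally show ?thesis
      using k by blast
  qed
  then obtain s where s: "\<And>n. s n \<ge> n" "\<And>n. dist ((f ^^ s n) a) a < inverse (real (Suc n))"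
    by metis
  show ?thesis
  proof
    show "filterlim s at_top sequentially"
      by (rule filterlim_at_top_mono[OF filterlim_ident]) (use s(1) in auto)
    have "(\<lambda>n. dist ((f ^^ s n) a) a) \<longlonglongrightarrow> 0"
      by (rule tendsto_sandwich[OF _ _ tendsto_const LIMSEQ_inverse_real_of_nat])
        (use s(2) in \<open>auto intro!: always_eventually less_imp_le simp del: of_nat_Suc\<close>)
    then show "(\<lambda>j. (f ^^ s j) a) \<longlonglongrightarrow> a"
      by (rule tendsto_dist_iff[THEN iffD2])
  qed
qed

lemma orthogonal_transformation_funpow:
  fixes f :: "'a::real_inner \<Rightarrow> 'a"
  shows "orthogonal_transformation f \<Longrightarrow> orthogonal_transformation (f ^^ k)"
proof (induction k)
  case 0
  then show ?case
    by (simp add: id_def)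
next
  case (Suc k)
  then show ?case
    using orthogonal_transformation_compose[of f "f ^^ k"] unfolding funpow.simps by blast
qed

lemma orthogonal_transformation_recurrent:
  fixes Q :: "'a::euclidean_space \<Rightarrow> 'a"
  assumes "orthogonal_transformation Q"
  obtains s :: "nat \<Rightarrow> nat"
  where "filterlim s at_top sequentially"
    "(\<lambda>j. (Q ^^ s j) a) \<longlonglongrightarrow> a" "(\<lambda>j. (Q ^^ s j) b) \<longlonglongrightarrow> b"
proof -
  have pow: "(map_prod Q Q ^^ k) (a, b) = ((Q ^^ k) a, (Q ^^ k) b)" for k
    by (induction k) auto
  have "norm ((Q ^^ k) x) = norm x" for k x
    using orthogonal_transformation_funpow[OF assms] by (simp add: orthogonal_transformation)
  then have "bounded (range (\<lambda>k. (map_prod Q Q ^^ k) (a, b)))"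
    unfolding bounded_iff by (intro exI[of _ "norm (a, b)"]) (auto simp: pow norm_Pair)
  moreover have "dist (map_prod Q Q x) (map_prod Q Q y) = dist x y" for x y
    using assms by (cases x; cases y) (auto simp: orthogonal_transformation_isometry dist_Pair_Pair)
  ultimately obtain s :: "nat \<Rightarrow> nat" where s: "filterlim s at_top sequentially"
      "(\<lambda>j. (map_prod Q Q ^^ s j) (a, b)) \<longlonglongrightarrow> (a, b)"
    using isometry_recurrent by blast
  show ?thesis
    using that[OF s(1)] tendsto_fst[OF s(2)] tendsto_snd[OF s(2)] by (simp add: pow)
qed

section \<open>Resilience implies common distance\<close>

lemma similarity_imp_affine:
  assumes "similarity \<sigma>"
  obtains \<alpha> Q v where "\<alpha> > 0" "orthogonal_transformation Q" "\<sigma> = (\<lambda>x. \<alpha> *\<^sub>R Q x + v)"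
proof -
  obtain \<alpha> where \<alpha>: "\<alpha> > 0" and dist: "\<And>x y. dist (\<sigma> x) (\<sigma> y) = \<alpha> * dist x y"
    using assms unfolding similarity_def by blast
  define Q where "Q x = (\<sigma> x - \<sigma> 0) /\<^sub>R \<alpha>" for x
  have "dist (Q x) (Q y) = dist x y" for x y
  proof -
    have "Q x - Q y = (\<sigma> x - \<sigma> y) /\<^sub>R \<alpha>"
      by (simp add: Q_def algebra_simps)
    then show ?thesis
      using \<alpha> dist[of x y] by (simp add: dist_norm)
  qed
  then have "orthogonal_transformation Q"
    unfolding orthogonal_transformation_isometry by (simp add: Q_def)
  moreover have "\<sigma> = (\<lambda>x. \<alpha> *\<^sub>R Q x + \<sigma> 0)"
    using \<alpha> by (auto simp: Q_def)
  ultimately show ?thesis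
    using that \<alpha> by blast
qed

lemma similarity_fixed_point:
  fixes Q :: "'a::euclidean_space \<Rightarrow> 'a"
  assumes "orthogonal_transformation Q" "\<alpha> > 0" "\<alpha> \<noteq> 1"
  obtains p where "\<alpha> *\<^sub>R Q p + v = p"
proof -
  have lin: "linear Q" and nQ: "\<And>x. norm (Q x) = norm x"
    using assms(1) by (auto simp: orthogonal_transformation)
  define D where "D x = x - \<alpha> *\<^sub>R Q x" for x
  have "linear D"
    unfolding D_def using lin by (intro linear_compose_sub linear_compose_scale_right) (auto simp: linear_ident)
  moreover have "x = 0" if "D x = 0" for x
  proof -
    have "x = \<alpha> *\<^sub>R Q x"
      using that by (simp add: D_def)
    then have "norm x = \<alpha> * norm x"
      using assms(2) nQ by (metis abs_of_pos norm_scaleR)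
    then show ?thesis
      using assms(3) by simp
  qed
  ultimately have "surj D"
    by (intro linear_injective_imp_surjective) (auto simp: linear_injective_0)
  then obtain p where "D p = v"
    by (metis surjD)
  then have "\<alpha> *\<^sub>R Q p + v = p"
    by (auto simp: D_def)
  then show ?thesis
    by (rule that)
qed

locale resilient_set =
  fixes X :: "(real ^ 'n) set" and r \<alpha> :: real and Q :: "real ^ 'n \<Rightarrow> real ^ 'n"
    and v :: "real ^ 'n" and \<sigma> :: "real ^ 'n \<Rightarrow> real ^ 'n"
  assumes r_pos: "r > 0" and \<alpha>_pos: "\<alpha> > 0" and Q: "orthogonal_transformation Q"
    and \<sigma>_def: "\<sigma> = (\<lambda>x. \<alpha> *\<^sub>R Q x + v)"
    and expansion_eq: "expansion r X = \<sigma> ` X"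
begin

lemma Q_pow_orthogonal: "orthogonal_transformation (Q ^^ k)"
  using Q by (rule orthogonal_transformation_funpow)

lemma norm_Q_pow [simp]: "norm ((Q ^^ k) x) = norm x"
  using Q_pow_orthogonal by (simp add: orthogonal_transformation)

lemma inner_Q_pow [simp]: "(Q ^^ k) x \<bullet> (Q ^^ k) y = x \<bullet> y"
  using Q_pow_orthogonal by (simp add: orthogonal_transformation_def)

lemma Q_pow_preimage: "\<exists>b. (Q ^^ k) b = a"
  using orthogonal_transformation_surj[OF Q_pow_orthogonal] by (metis surjD)

lemma \<sigma>_pow: "(\<sigma> ^^ k) x = \<alpha> ^ k *\<^sub>R (Q ^^ k) x + (\<sigma> ^^ k) 0"
proof (induction k arbitrary: x)
  case (Suc k)
  have lin: "linear Q"
    using Q by (simp add: orthogonal_transformation)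
  have "(\<sigma> ^^ Suc k) x = \<sigma> (\<alpha> ^ k *\<^sub>R (Q ^^ k) x + (\<sigma> ^^ k) 0)"
    using Suc[of x] by simp
  also have "\<dots> = \<alpha> ^ Suc k *\<^sub>R (Q ^^ Suc k) x + (\<sigma> ^^ Suc k) 0"
    by (simp add: \<sigma>_def linear_add[OF lin] linear_scale[OF lin] algebra_simps)
  finally show ?case .
qed simp

definition total_radius :: "nat \<Rightarrow> real" where
  "total_radius k = r * (\<Sum>i<k. \<alpha> ^ i)"

lemma total_radius_Suc: "total_radius (Suc k) = r + \<alpha> * total_radius k"
  unfolding total_radius_def sum.lessThan_Suc_shift
  by (simp add: sum_distrib_left algebra_simps)

text \<open>The image of \<open>X\<close> under \<open>\<sigma> ^^ k\<close> is, for \<open>k > 0\<close>, the expansion of \<open>X\<close> by the sum of the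
  radii \<open>r \<alpha>\<^sup>i\<close>, \<open>i < k\<close>; this is its dual form. Transporting the functional back along one step
  of \<open>\<sigma>\<close> scales its norm by \<open>\<alpha>\<close>, which turns the radius sum for \<open>k\<close> into the one for \<open>k + 1\<close>.\<close>

lemma bounded_above_on_image_iff:
  "(\<forall>x\<in>X. a \<bullet> (\<sigma> ^^ k) x \<le> b + total_radius k * norm a) \<longleftrightarrow> (\<forall>x\<in>X. a \<bullet> x \<le> b)"
proof (induction k arbitrary: a b)
  case 0
  then show ?case
    by (simp add: total_radius_def)
next
  case (Suc k)
  obtain c where c: "Q c = a"
    using Q_pow_preimage[of 1 a] by auto
  have nc: "norm a = norm c"
    using norm_Q_pow[of 1 c] c by simp
  have "a \<bullet> Q w = c \<bullet> w" for w
    using inner_Q_pow[of 1 c w] c by simp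
  then have a\<sigma>: "a \<bullet> \<sigma> w = (\<alpha> *\<^sub>R c) \<bullet> w + a \<bullet> v" for w
    by (simp add: \<sigma>_def inner_add_right)
  have "(\<forall>x\<in>X. a \<bullet> (\<sigma> ^^ Suc k) x \<le> b + total_radius (Suc k) * norm a) \<longleftrightarrow>
      (\<forall>x\<in>X. (\<alpha> *\<^sub>R c) \<bullet> (\<sigma> ^^ k) x \<le>
        (b + r * norm a - a \<bullet> v) + total_radius k * norm (\<alpha> *\<^sub>R c))"
    using \<alpha>_pos by (auto simp: a\<sigma> total_radius_Suc nc algebra_simps)
  also have "\<dots> \<longleftrightarrow> (\<forall>x\<in>X. (\<alpha> *\<^sub>R c) \<bullet> x \<le> b + r * norm a - a \<bullet> v)"
    by (rule Suc.IH)
  also have "\<dots> \<longleftrightarrow> (\<forall>z\<in>expansion r X. a \<bullet> z \<le> b + r * norm a)"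
    by (auto simp: expansion_eq a\<sigma> algebra_simps)
  also have "\<dots> \<longleftrightarrow> (\<forall>x\<in>X. a \<bullet> x \<le> b)"
    by (rule bounded_above_on_expansion_iff[OF r_pos])
  finally show ?case .
qed

text \<open>The bounds are the two halves of this duality, evaluated at a contact point. The upper one
  tests the image against \<open>a\<close>, whose supremum over \<open>X\<close> is known; the lower one tests it against
  the rotated normal, whose supremum over the image is known.\<close>

lemma image_upper_bound:
  assumes "outward_normal X y a"
  shows "\<alpha> ^ k * (a \<bullet> (Q ^^ k) y) + a \<bullet> (\<sigma> ^^ k) 0 \<le> a \<bullet> y + total_radius k"
proof -
  have n: "norm a = 1" "y \<in> closure X" "\<forall>x\<in>X. a \<bullet> x \<le> a \<bullet> y"
    using assms by (auto simp: outward_normal_def)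
  obtain c where c: "(Q ^^ k) c = a"
    using Q_pow_preimage by blast
  have pull: "a \<bullet> (Q ^^ k) w = c \<bullet> w" for w
    using inner_Q_pow[of k c w] c by simp
  have "\<forall>x\<in>X. a \<bullet> (\<sigma> ^^ k) x \<le> a \<bullet> y + total_radius k * norm a"
    using n(3) by (rule bounded_above_on_image_iff[THEN iffD2])
  then have "\<forall>x\<in>X. (\<alpha> ^ k *\<^sub>R c) \<bullet> x \<le> a \<bullet> y + total_radius k - a \<bullet> (\<sigma> ^^ k) 0"
    by (subst (asm) \<sigma>_pow) (auto simp: inner_add_right pull n(1) algebra_simps)
  from inner_le_on_closure[OF this n(2)] show ?thesis
    by (simp add: pull)
qed

lemma image_lower_bound:
  assumes "outward_normal X y a"
  shows "(Q ^^ k) a \<bullet> y + total_radius k \<le> \<alpha> ^ k * (a \<bullet> y) + (Q ^^ k) a \<bullet> (\<sigma> ^^ k) 0"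
proof -
  have n: "norm a = 1" "y \<in> closure X" "\<forall>x\<in>X. a \<bullet> x \<le> a \<bullet> y"
    using assms by (auto simp: outward_normal_def)
  define b where "b = \<alpha> ^ k * (a \<bullet> y) + (Q ^^ k) a \<bullet> (\<sigma> ^^ k) 0 - total_radius k"
  have "(Q ^^ k) a \<bullet> (\<sigma> ^^ k) x \<le> b + total_radius k * norm ((Q ^^ k) a)" if "x \<in> X" for x
    using n that \<alpha>_pos by (subst \<sigma>_pow) (auto simp: inner_add_right b_def)
  then have "\<forall>x\<in>X. (Q ^^ k) a \<bullet> x \<le> b"
    using bounded_above_on_image_iff by blast
  from inner_le_on_closure[OF this n(2)] show ?thesis
    by (simp add: b_def)
qed

end

lemma nonneg_if_mult_power_bounded_below:
  fixes t :: real
  assumes "\<beta> > 1" "\<And>k. - M \<le> \<beta> ^ k * t"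
  shows "t \<ge> 0"
proof (rule ccontr)
  assume "\<not> t \<ge> 0"
  then have t: "- t > 0"
    by simp
  obtain k where "(M + 1) / (- t) < \<beta> ^ k"
    using real_arch_pow[OF assms(1)] by blast
  then have "M + 1 < \<beta> ^ k * (- t)"
    using t by (simp only: pos_divide_less_eq)
  then show False
    using assms(2)[of k] by simp
qed

lemma limit_le_if_le_geometric:
  fixes t :: real
  assumes "\<beta> > 1" "filterlim s at_top sequentially" "L \<longlonglongrightarrow> l"
    and "\<And>j. L j \<le> inverse \<beta> ^ s j * t + c"
  shows "l \<le> c"
proof (rule tendsto_le[OF _ _ assms(3)])
  have "(\<lambda>k. inverse \<beta> ^ k) \<longlonglongrightarrow> 0"
    using assms(1) by (intro LIMSEQ_power_zero) (simp add: inverse_less_1_iff)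
  then have "(\<lambda>j. inverse \<beta> ^ s j) \<longlonglongrightarrow> 0"
    using assms(2) by (rule filterlim_compose)
  then show "(\<lambda>j. inverse \<beta> ^ s j * t + c) \<longlonglongrightarrow> c"
    by (auto intro!: tendsto_eq_intros)
qed (auto simp: assms(4))

context resilient_set
begin

text \<open>For \<open>\<alpha> \<noteq> 1\<close> measure from the fixed point \<open>p\<close> and put \<open>c = r / (\<alpha> - 1)\<close>. The deviation of the
  signed distance from \<open>c\<close> is multiplied by \<open>\<alpha>\<close> under \<open>\<sigma>\<close>, while the normal only rotates. In the
  expanding time direction the deviation cannot be negative, because signed distances are bounded
  below; in the contracting one it tends to \<open>0\<close>, and recurrence of the rotation brings the
  normal back, so it cannot be positive. For \<open>\<alpha> < 1\<close> the two bounds exchange their roles.\<close>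

lemma signed_distance_eq:
  assumes "\<alpha> \<noteq> 1" and p: "\<sigma> p = p" and n: "outward_normal X y a"
  shows "a \<bullet> (y - p) = r / (\<alpha> - 1)"
proof -
  define c where "c = r / (\<alpha> - 1)"
  define w where "w = y - p"
  define t where "t = a \<bullet> w - c"
  have na: "norm a = 1"
    using n by (simp add: outward_normal_def)
  have radius: "total_radius k = c * (\<alpha> ^ k - 1)" for k
    using assms(1) by (simp add: total_radius_def c_def geometric_sum)
  have linQ: "linear (Q ^^ k)" for k
    using Q_pow_orthogonal by (auto simp: orthogonal_transformation)
  have "(\<sigma> ^^ k) p = p" for k
    using p by (induction k) auto
  then have \<sigma>0: "(\<sigma> ^^ k) 0 = p - \<alpha> ^ k *\<^sub>R (Q ^^ k) p" for k
    using \<sigma>_pow[of k p] by (metis add_diff_cancel_left')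
  have upper: "\<alpha> ^ k * (a \<bullet> (Q ^^ k) w) \<le> t + c * \<alpha> ^ k" for k
    using image_upper_bound[OF n, of k]
    by (simp add: \<sigma>0 radius w_def t_def linear_diff[OF linQ] algebra_simps)
  have lower: "(Q ^^ k) a \<bullet> w \<le> \<alpha> ^ k * t + c" for k
    using image_lower_bound[OF n, of k]
    by (simp add: \<sigma>0 radius w_def t_def algebra_simps)
  have upper': "a \<bullet> (Q ^^ k) w \<le> inverse \<alpha> ^ k * t + c" for k
  proof -
    have "a \<bullet> (Q ^^ k) w \<le> (t + c * \<alpha> ^ k) / \<alpha> ^ k"
      using upper[of k] \<alpha>_pos by (simp add: pos_le_divide_eq mult.commute)
    also have "\<dots> = t / \<alpha> ^ k + c"
      using \<alpha>_pos by (simp add: add_divide_distrib)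
    also have "t / \<alpha> ^ k = inverse \<alpha> ^ k * t"
      by (simp add: power_inverse divide_inverse mult.commute)
    finally show ?thesis .
  qed
  have bound_Qw: "- norm w \<le> a \<bullet> (Q ^^ k) w" and bound_Qa: "- norm w \<le> (Q ^^ k) a \<bullet> w" for k
    using Cauchy_Schwarz_ineq2[of a "(Q ^^ k) w"] Cauchy_Schwarz_ineq2[of "(Q ^^ k) a" w] na
    by auto
  obtain s :: "nat \<Rightarrow> nat" where s: "filterlim s at_top sequentially"
      "(\<lambda>j. (Q ^^ s j) a) \<longlonglongrightarrow> a" "(\<lambda>j. (Q ^^ s j) w) \<longlonglongrightarrow> w"
    using orthogonal_transformation_recurrent[OF Q] by blast
  have "t \<ge> 0 \<and> a \<bullet> w \<le> c"
  proof (cases "\<alpha> > 1")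
    case True
    have "- (norm w + c) \<le> \<alpha> ^ k * t" for k
      using lower[of k] bound_Qa[of k] by linarith
    then have "t \<ge> 0"
      by (rule nonneg_if_mult_power_bounded_below[OF True])
    moreover have "a \<bullet> w \<le> c"
      by (rule limit_le_if_le_geometric[OF True s(1) _ upper']) (intro tendsto_intros s)
    ultimately show ?thesis ..
  next
    case False
    then have \<beta>: "inverse \<alpha> > 1"
      using assms(1) \<alpha>_pos by (simp add: one_less_inverse_iff)
    have "- (norm w + c) \<le> inverse \<alpha> ^ k * t" for k
      using upper'[of k] bound_Qw[of k] by linarith
    then have "t \<ge> 0"
      by (rule nonneg_if_mult_power_bounded_below[OF \<beta>])
    moreover have "a \<bullet> w \<le> c"
    proof (rule limit_le_if_le_geometric[OF \<beta> s(1)])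
      show "(\<lambda>j. (Q ^^ s j) a \<bullet> w) \<longlonglongrightarrow> a \<bullet> w"
        by (intro tendsto_intros s)
    qed (use lower in simp)
    ultimately show ?thesis ..
  qed
  then show ?thesis
    by (simp add: t_def w_def c_def)
qed

text \<open>For \<open>\<alpha> = 1\<close> the translation part of \<open>\<sigma> ^^ k\<close>, whose length grows at most linearly, advances by
  \<open>k r\<close> along every normal, up to \<open>o(k)\<close> at the return times of the rotation. Along the sum of two normals it
  therefore advances by about \<open>2 k r\<close>, but it can advance by at most \<open>k r\<close> times the norm of
  that sum. Hence the sum of the two unit vectors has norm \<open>2\<close>.\<close>

lemma outward_normals_eq:
  assumes "\<alpha> = 1" "X \<noteq> {}" and n1: "outward_normal X y1 a1" and n2: "outward_normal X y2 a2"
  shows "a1 = a2"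
proof -
  have unit: "norm a1 = 1" "norm a2 = 1"
    using n1 n2 by (auto simp: outward_normal_def)
  have radius: "total_radius k = r * real k" for k
    unfolding total_radius_def by (simp add: assms(1))
  define V where "V k = (\<sigma> ^^ k) 0" for k
  have normV: "norm (V k) \<le> real k * norm v" for k
  proof (induction k)
    case (Suc k)
    have "norm (V (Suc k)) \<le> norm (Q (V k)) + norm v"
      by (simp add: V_def \<sigma>_def assms(1) norm_triangle_ineq)
    also have "norm (Q (V k)) = norm (V k)"
      using norm_Q_pow[of 1] by simp
    finally show ?case
      using Suc by (simp add: algebra_simps)
  qed (simp add: V_def)
  define drift where "drift a k = norm ((Q ^^ k) a - a) * norm v" for a k
  have advance: "real k * r \<le> 2 * norm y + a \<bullet> V k + real k * drift a k"
    if n: "outward_normal X y a" for y a k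
  proof -
    have na: "norm a = 1"
      using n by (simp add: outward_normal_def)
    have "(Q ^^ k) a \<bullet> y + real k * r \<le> a \<bullet> y + (Q ^^ k) a \<bullet> V k"
      using image_lower_bound[OF n, of k] unfolding radius by (simp add: assms(1) V_def mult.commute)
    moreover have "- norm y \<le> (Q ^^ k) a \<bullet> y" "a \<bullet> y \<le> norm y"
      using Cauchy_Schwarz_ineq2[of a y] Cauchy_Schwarz_ineq2[of "(Q ^^ k) a" y]
      by (simp_all add: na abs_le_iff)
    moreover have "((Q ^^ k) a - a) \<bullet> V k \<le> real k * drift a k"
    proof -
      have "((Q ^^ k) a - a) \<bullet> V k \<le> norm ((Q ^^ k) a - a) * norm (V k)"
        by (rule norm_cauchy_schwarz)
      also have "\<dots> \<le> norm ((Q ^^ k) a - a) * (real k * norm v)"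
        by (intro mult_left_mono normV) auto
      finally show ?thesis
        by (simp add: drift_def algebra_simps)
    qed
    ultimately show ?thesis
      by (simp add: inner_diff_left)
  qed
  define e where "e = a1 + a2"
  obtain x where x: "x \<in> X"
    using assms(2) by blast
  define b where "b = a1 \<bullet> y1 + a2 \<bullet> y2"
  have "\<forall>x\<in>X. e \<bullet> x \<le> b"
    using n1 n2 by (auto simp: outward_normal_def e_def b_def inner_add_left intro: add_mono)
  then have sum_bound: "e \<bullet> (\<sigma> ^^ k) x \<le> b + real k * r * norm e" for k
    using bounded_above_on_image_iff[of e k b] x unfolding radius by (simp add: mult.commute)
  have advance_sum: "e \<bullet> V k \<le> norm e * norm x + b + real k * r * norm e" for k
  proof -
    have "(\<sigma> ^^ k) x = (Q ^^ k) x + V k"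
      using \<sigma>_pow[of k x] by (simp add: V_def assms(1))
    then have "e \<bullet> (\<sigma> ^^ k) x = e \<bullet> (Q ^^ k) x + e \<bullet> V k"
      by (simp add: inner_add_right)
    moreover have "\<bar>e \<bullet> (Q ^^ k) x\<bar> \<le> norm e * norm x"
      using Cauchy_Schwarz_ineq2[of e "(Q ^^ k) x"] by simp
    ultimately show ?thesis
      using sum_bound[of k] by linarith
  qed
  define C where "C = 2 * norm y1 + 2 * norm y2 + norm e * norm x + b"
  have main: "real k * (r * (2 - norm e)) \<le> C + real k * (drift a1 k + drift a2 k)" for k
    using advance[OF n1, of k] advance[OF n2, of k] advance_sum[of k]
    by (simp add: C_def e_def algebra_simps)
  obtain s :: "nat \<Rightarrow> nat" where s: "filterlim s at_top sequentially"
      "(\<lambda>j. (Q ^^ s j) a1) \<longlonglongrightarrow> a1" "(\<lambda>j. (Q ^^ s j) a2) \<longlonglongrightarrow> a2"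
    using orthogonal_transformation_recurrent[OF Q] by blast
  have "(\<lambda>j. drift a (s j)) \<longlonglongrightarrow> 0" if "(\<lambda>j. (Q ^^ s j) a) \<longlonglongrightarrow> a" for a
    unfolding drift_def using that by (auto intro!: tendsto_eq_intros)
  then have drift0: "(\<lambda>j. drift a1 (s j)) \<longlonglongrightarrow> 0" "(\<lambda>j. drift a2 (s j)) \<longlonglongrightarrow> 0"
    using s by blast+
  have "(\<lambda>j. C / real (s j)) \<longlonglongrightarrow> 0"
    by (rule real_tendsto_divide_at_top[OF tendsto_const])
      (rule filterlim_compose[OF filterlim_real_sequentially s(1)])
  then have "(\<lambda>j. C / real (s j) + (drift a1 (s j) + drift a2 (s j))) \<longlonglongrightarrow> 0"
    using tendsto_add[OF _ tendsto_add[OF drift0]] by fastforce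
  moreover have "eventually (\<lambda>j. s j \<ge> 1) sequentially"
    using s(1) by (simp add: filterlim_at_top)
  then have "eventually (\<lambda>j. r * (2 - norm e) \<le>
      C / real (s j) + (drift a1 (s j) + drift a2 (s j))) sequentially"
  proof eventually_elim
    case (elim j)
    have "r * (2 - norm e) \<le> (C + real (s j) * (drift a1 (s j) + drift a2 (s j))) / real (s j)"
      using main[of "s j"] elim by (simp add: pos_le_divide_eq mult.commute)
    then show ?case
      using elim by (simp add: add_divide_distrib)
  qed
  ultimately have "r * (2 - norm e) \<le> 0"
    by (intro tendsto_lowerbound[where F = sequentially]) auto
  then have "norm e \<ge> 2"
    using r_pos by (simp add: mult_le_0_iff)
  then have "(norm e)\<^sup>2 \<ge> 2\<^sup>2"
    by (intro power_mono) auto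
  moreover have "(norm e)\<^sup>2 = 2 + 2 * (a1 \<bullet> a2)"
    using unit by (simp add: e_def power2_norm_eq_inner inner_add_left inner_add_right
        norm_eq_1 inner_commute)
  ultimately have "(a1 - a2) \<bullet> (a1 - a2) \<le> 0"
    using unit by (simp add: inner_diff_left inner_diff_right norm_eq_1 inner_commute)
  then have "(a1 - a2) \<bullet> (a1 - a2) = 0"
    by (intro antisym) auto
  then show ?thesis
    by simp
qed

lemma supports_at_some_common_distance: "\<exists>R>0. \<exists>p. supports_at_common_distance X p R"
proof (cases "\<exists>y a. outward_normal X y a")
  case False
  then show ?thesis
    unfolding supports_at_common_distance_iff by (intro exI[of _ 1]) auto
next
  case True
  then obtain y0 a0 where n0: "outward_normal X y0 a0"
    by blast
  show ?thesis
  proof (cases "\<alpha> = 1")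
    case True
    have "X \<noteq> {}"
      using n0 by (auto simp: outward_normal_def)
    then have eq: "a = a0" if "outward_normal X y a" for y a
      using outward_normals_eq[OF True _ that n0] by blast
    have "a \<bullet> (y - (y0 - a0)) = 1" if n: "outward_normal X y a" for y a
    proof -
      have "a0 \<bullet> y = a0 \<bullet> y0"
        using outward_normal_le n n0 eq[OF n] by (metis antisym outward_normal_def)
      then show ?thesis
        using n0 eq[OF n] by (simp add: outward_normal_def norm_eq_1 inner_diff_right)
    qed
    then show ?thesis
      unfolding supports_at_common_distance_iff
      by (intro exI[of _ 1] conjI exI[of _ "y0 - a0"]) auto
  next
    case False
    obtain p where "\<alpha> *\<^sub>R Q p + v = p"
      using similarity_fixed_point[OF Q \<alpha>_pos False] .
    then have p: "\<sigma> p = p"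
      by (simp add: \<sigma>_def)
    have "\<forall>y a. outward_normal X y a \<longrightarrow> \<bar>a \<bullet> (y - p)\<bar> = \<bar>r / (\<alpha> - 1)\<bar>"
      using signed_distance_eq[OF False p] by simp
    moreover have "\<bar>r / (\<alpha> - 1)\<bar> > 0"
      using r_pos False by simp
    ultimately show ?thesis
      unfolding supports_at_common_distance_iff by blast
  qed
qed

end

theorem theorem3p4:
  fixes X :: "(real ^ 'n) set"
  assumes "open X" and "convex X"
  shows "((\<exists>r>0. resilient_to_expansion r X) \<longleftrightarrow>
            (\<exists>r>0. \<exists>R>r. \<exists>p. supports_at_common_distance X p R)) \<and>
         (\<forall>r>0. (\<exists>R>r. \<exists>p. supports_at_common_distance X p R) \<longrightarrow> resilient_to_expansion r X)"
proof -
  have sufficient: "resilient_to_expansion r X"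
    if "r > 0" "\<exists>R>r. \<exists>p. supports_at_common_distance X p R" for r
    using resilient_if_supports_at_common_distance[OF assms] that by (meson order_less_trans)
  have necessary: "\<exists>r>0. \<exists>R>r. \<exists>p. supports_at_common_distance X p R"
    if "r > 0" "resilient_to_expansion r X" for r
  proof -
    obtain \<sigma> where \<sigma>: "similarity \<sigma>" "expansion r X = \<sigma> ` X"
      using \<open>resilient_to_expansion r X\<close> unfolding resilient_to_expansion_def by blast
    obtain \<alpha> Q v where "\<alpha> > 0" "orthogonal_transformation Q" "\<sigma> = (\<lambda>x. \<alpha> *\<^sub>R Q x + v)"
      using similarity_imp_affine[OF \<sigma>(1)] by blast
    then interpret resilient_set X r \<alpha> Q v \<sigma>
      by unfold_locales (use \<open>r > 0\<close> \<sigma>(2) in auto)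
    obtain R p where R: "R > 0" "supports_at_common_distance X p R"
      using supports_at_some_common_distance by blast
    have "R / 2 > 0" "R > R / 2"
      using R(1) by auto
    then show ?thesis
      using R(2) by blast
  qed
  show ?thesis
    using sufficient necessary by blast
qed

end
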